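(* Let $\beta>0$ be a constant and let $p$ be a real number with $p\ge 2\beta$ and $p\ge 1$. Then $$B(p,\beta)^{1/p}\ \le\ \frac{p/e}{\ln(p/\beta)-\ln\ln(p/\beta)}\cdot\exp\left\{\frac{1}{\ln(p/\beta)}-\frac{1}{p/\beta}\right\}.$$
   Context: The Bell function of two variables is $B(p,\beta)=e^{-\beta}\sum_{k=0}^{\infty}\frac{k^p\,\beta^k}{k!}$ for real $p>0$ and $\beta>0$. Equivalently, $B(p,\beta)={\bf E}(\tau^p)$ where $\tau$ is a Poisson random variable with parameter $\beta$. Here $\ln$ is the natural logarithm. *)

theory Defs
  imports Complex_Main
begin

(* For p > 0 the k = 0 term vanishes, matching 0^p = 0, since 0 powr p = 0. *)
definition Bell :: "real \<Rightarrow> real \<Rightarrow> real" where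
  "Bell p \<beta> = exp (- \<beta>) * (\<Sum>k. real k powr p * \<beta> ^ k / fact k)"

end

theory Submission
  imports Defs
begin

text \<open>
  Chernoff's method: since \<open>ln y \<le> y - 1\<close>, the power \<open>x powr p\<close> is at most
  \<open>(p / (e * l)) powr p * exp (l * x)\<close> for every \<open>l > 0\<close>, so the \<open>p\<close>-th moment of a Poisson
  variable is controlled by its moment generating function \<open>exp (\<beta> * (exp l - 1))\<close>.
  With \<open>r = p / \<beta>\<close>, the choice \<open>exp l = r / ln r\<close> gives the claimed bound.
\<close>

lemma powr_le_exp:
  fixes x p l :: real
  assumes "x \<ge> 0" "p > 0" "l > 0"
  shows "x powr p \<le> (p / (exp 1 * l)) powr p * exp (l * x)"
proof (cases "x = 0")
  case False
  with assms have x: "x > 0" by simp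
  \<comment> \<open>The tangent bound is used at \<open>l * x / p\<close>, so it is sharp at
    \<open>x = p / l\<close>, where \<open>x powr p * exp (- l * x)\<close> is largest. The
    \<open>- p\<close> it produces becomes the \<open>exp 1\<close> in the denominator.\<close>
  have "ln (l * x / p) \<le> l * x / p - 1"
    using x assms by (intro ln_le_minus_one) simp
  hence "p * ln (l * x / p) \<le> p * (l * x / p - 1)"
    using assms by (intro mult_left_mono) auto
  also have "\<dots> = l * x - p"
    using assms by (simp add: field_simps)
  finally have "p * ln x \<le> p * ln (p / (exp 1 * l)) + l * x"
    using x assms by (simp add: ln_div ln_mult algebra_simps)
  hence "exp (p * ln x) \<le> exp (p * ln (p / (exp 1 * l)) + l * x)"
    by simp
  thus ?thesis
    using x assms by (simp add: powr_def exp_add)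
qed (use assms in simp)

text \<open>The weight \<open>exp (l * real k)\<close> merges with \<open>\<beta> ^ k\<close> into
  \<open>(\<beta> * exp l) ^ k\<close>, which leaves an exponential series.\<close>

lemma exp_mgf_sums:
  fixes \<beta> l :: real
  shows "(\<lambda>k. exp (l * real k) * \<beta> ^ k / fact k) sums exp (\<beta> * exp l)"
proof -
  have "(\<lambda>k. (\<beta> * exp l) ^ k /\<^sub>R fact k) sums exp (\<beta> * exp l)"
    by (rule exp_converges)
  moreover have "(\<beta> * exp l) ^ k /\<^sub>R fact k = exp (l * real k) * \<beta> ^ k / fact k" for k
    by (simp add: power_mult_distrib exp_of_nat2_mult mult.commute divide_inverse)
  ultimately show ?thesis
    by simp
qed

lemma Bell_term_le:
  fixes p \<beta> l :: real
  assumes "\<beta> \<ge> 0" "p > 0" "l > 0"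
  shows "real k powr p * \<beta> ^ k / fact k
    \<le> (p / (exp 1 * l)) powr p * (exp (l * real k) * \<beta> ^ k / fact k)"
proof -
  have "real k powr p * (\<beta> ^ k / fact k)
      \<le> (p / (exp 1 * l)) powr p * exp (l * real k) * (\<beta> ^ k / fact k)"
    using assms by (intro mult_right_mono powr_le_exp) auto
  thus ?thesis
    by (simp add: mult.assoc)
qed

lemma summable_Bell:
  fixes p \<beta> :: real
  assumes "\<beta> \<ge> 0" "p > 0"
  shows "summable (\<lambda>k. real k powr p * \<beta> ^ k / fact k)"
proof (rule summable_comparison_test')
  \<comment> \<open>Any positive \<open>l\<close> would give a summable majorant;
    \<open>l = 1\<close> is an arbitrary choice.\<close>
  show "summable (\<lambda>k. (p / (exp 1 * 1)) powr p * (exp (1 * real k) * \<beta> ^ k / fact k))"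
    by (intro summable_mult sums_summable[OF exp_mgf_sums])
  show "norm (real k powr p * \<beta> ^ k / fact k)
      \<le> (p / (exp 1 * 1)) powr p * (exp (1 * real k) * \<beta> ^ k / fact k)" for k
    using Bell_term_le[OF assms, of 1 k] assms by simp
qed

text \<open>Lets \<open>powr_mono2\<close> take the \<open>p\<close>-th root of the bound on
  \<open>Bell\<close>.\<close>

lemma Bell_nonneg:
  assumes "\<beta> \<ge> 0" "p > 0"
  shows "Bell p \<beta> \<ge> 0"
  unfolding Bell_def using assms
  by (intro mult_nonneg_nonneg suminf_nonneg summable_Bell) auto

lemma Bell_le_mgf:
  assumes "\<beta> \<ge> 0" "p > 0" "l > 0"
  shows "Bell p \<beta> \<le> (p / (exp 1 * l)) powr p * exp (\<beta> * (exp l - 1))"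
proof -
  define C where "C = (p / (exp 1 * l)) powr p"
  have "(\<lambda>k. C * (exp (l * real k) * \<beta> ^ k / fact k)) sums (C * exp (\<beta> * exp l))"
    by (intro sums_mult exp_mgf_sums)
  hence "(\<Sum>k. real k powr p * \<beta> ^ k / fact k) \<le> C * exp (\<beta> * exp l)"
    unfolding C_def
    by (rule sums_le[OF Bell_term_le[OF assms] summable_sums[OF summable_Bell[OF assms(1,2)]]])
  hence "Bell p \<beta> \<le> exp (- \<beta>) * (C * exp (\<beta> * exp l))"
    by (simp add: Bell_def)
  also have "\<dots> = C * exp (\<beta> * (exp l - 1))"
    by (simp add: algebra_simps exp_diff exp_minus divide_inverse)
  finally show ?thesis
    by (simp add: C_def)
qed

lemma Bell_root_le_mgf:
  assumes "\<beta> \<ge> 0" "p > 0" "l > 0"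
  shows "Bell p \<beta> powr (1 / p) \<le> p / exp 1 / l * exp (\<beta> / p * (exp l - 1))"
proof -
  have "Bell p \<beta> powr (1 / p)
      \<le> ((p / (exp 1 * l)) powr p * exp (\<beta> * (exp l - 1))) powr (1 / p)"
    using assms by (intro powr_mono2 Bell_le_mgf Bell_nonneg) auto
  also have "\<dots> = p / exp 1 / l * exp (\<beta> / p * (exp l - 1))"
    using assms by (simp add: powr_mult powr_powr exp_powr_real)
  finally show ?thesis .
qed

theorem proposition3p1:
  fixes p \<beta> :: real
  assumes "\<beta> > 0" and "p \<ge> 2 * \<beta>" and "p \<ge> 1"
  shows "Bell p \<beta> powr (1 / p)
    \<le> (p / exp 1) / (ln (p / \<beta>) - ln (ln (p / \<beta>)))
        * exp (1 / ln (p / \<beta>) - 1 / (p / \<beta>))"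
proof -
  define r where "r = p / \<beta>"
  \<comment> \<open>The best \<open>l\<close> in \<open>Bell_root_le_mgf\<close> solves
    \<open>l * exp l = r\<close>, that is \<open>l = ln r - ln l\<close>. Replacing \<open>l\<close>
    by \<open>ln r\<close> on the right gives this explicit approximation.\<close>
  define l where "l = ln r - ln (ln r)"
  have r: "r \<ge> 2"
    using assms by (simp add: r_def field_simps)
  \<comment> \<open>The second inequality gives \<open>ln (ln r) < ln r\<close>, hence
    \<open>l > 0\<close>.\<close>
  hence ln_r: "0 < ln r" "ln r < r"
    by (auto intro: ln_less_self)
  hence "l > 0"
    using r by (simp add: l_def)
  have "exp l = r / ln r"
    using r ln_r by (simp add: l_def exp_diff)
  \<comment> \<open>Since \<open>\<beta> / p = 1 / r\<close>, the factor \<open>r\<close> in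
    \<open>exp l\<close> cancels.\<close>
  hence "\<beta> / p * (exp l - 1) = 1 / ln r - 1 / r"
    using assms ln_r by (simp add: r_def field_simps)
  with Bell_root_le_mgf[of \<beta> p l] \<open>l > 0\<close> assms show ?thesis
    by (simp add: l_def r_def)
qed

end
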